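(* Let $G$ be a connected graph on $6$ vertices with $7$ or $8$ edges, and let $\mathcal{G}$ be a $P_4$-intersecting family of subgraphs of $G$. Then $$\frac{|\mathcal{G}|}{2^{|E(G)|}} \le \frac{17}{128}.$$
   Context: $P_4$ is the path on four vertices (with three edges). Subgraphs of the host graph $G$ are labelled and identified with their edge sets (so $G$ has $2^{|E(G)|}$ subgraphs). A family $\mathcal{G}$ of subgraphs of $G$ is $P_4$-intersecting if for any two graphs $F, F' \in \mathcal{G}$, the edge intersection $F \cap F'$ contains a subgraph isomorphic to $P_4$. The density of such a family is $|\mathcal{G}|/2^{|E(G)|}$; taking all supergraphs in $K_n$ of the members of $\mathcal{G}$ yields a $P_4$-intersecting family on $K_n$ of size $(|\mathcal{G}|/2^{|E(G)|})\cdot 2^{\binom{n}{2}}$, called the family generated from the host graph $G$. *)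

theory Defs
  imports Complex_Main
begin

text \<open>A graph is given by its vertex set and its edge set; an undirected edge is the two-element
  set of its end vertices, so graphs are simple.\<close>

definition is_graph :: "'a set \<Rightarrow> 'a set set \<Rightarrow> bool" where
  "is_graph V E \<longleftrightarrow> finite V \<and> (\<forall>e\<in>E. e \<subseteq> V \<and> card e = 2)"

definition connected_graph :: "'a set \<Rightarrow> 'a set set \<Rightarrow> bool" where
  "connected_graph V E \<longleftrightarrow>
     is_graph V E \<and> V \<noteq> {} \<and> (\<forall>u\<in>V. \<forall>v\<in>V. (u, v) \<in> {(x, y). {x, y} \<in> E}\<^sup>*)"

definition is_subgraph :: "'a set \<Rightarrow> 'a set set \<Rightarrow> 'a set \<Rightarrow> 'a set set \<Rightarrow> bool" where
  "is_subgraph W D V E \<longleftrightarrow> is_graph W D \<and> is_graph V E \<and> W \<subseteq> V \<and> D \<subseteq> E"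

definition graph_iso :: "'a set \<Rightarrow> 'a set set \<Rightarrow> 'b set \<Rightarrow> 'b set set \<Rightarrow> bool" where
  "graph_iso V E W D \<longleftrightarrow>
     (\<exists>f. bij_betw f V W \<and> (\<forall>u\<in>V. \<forall>v\<in>V. {u, v} \<in> E \<longleftrightarrow> {f u, f v} \<in> D))"

text \<open>The subscript in \<open>P\<^sub>4\<close> counts vertices.\<close>

definition P4_verts :: "nat set" where
  "P4_verts = {0, 1, 2, 3}"

definition P4_edges :: "nat set set" where
  "P4_edges = {{0, 1}, {1, 2}, {2, 3}}"

definition contains_P4 :: "'a set \<Rightarrow> 'a set set \<Rightarrow> bool" where
  "contains_P4 V F \<longleftrightarrow>
     (\<exists>W D. is_subgraph W D V F \<and> graph_iso P4_verts P4_edges W D)"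

text \<open>Subgraphs of a host graph \<open>(V, E)\<close> are labelled and identified with their edge sets, i.e. with
  the elements of \<open>Pow E\<close>; an edge set \<open>F\<close> stands for the spanning subgraph \<open>(V, F)\<close>. The two
  members \<open>F\<close> and \<open>F'\<close> are allowed to coincide.\<close>

definition P4_intersecting :: "'a set \<Rightarrow> 'a set set \<Rightarrow> 'a set set set \<Rightarrow> bool" where
  "P4_intersecting V E \<G> \<longleftrightarrow>
     \<G> \<subseteq> Pow E \<and> (\<forall>F\<in>\<G>. \<forall>F'\<in>\<G>. contains_P4 V (F \<inter> F'))"

end

theory Submission
  imports Defs
begin

text \<open>A graph with $7$ edges may be enlarged by an edge outside it: adjoining this edge to
the members of a family in all possible ways doubles the family. So it suffices to bound a
path-intersecting family \<open>\<G>\<close> on a host with $8$ edges, and without isolated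
vertex, by $34 = 256 \cdot 17 / 128$.

Two ideas make this a small finite problem for each host. The first is that \<open>F \<in>
\<G>\<close> meets every member in a path that lies in \<open>F\<close>, so every member contains
the edges common to all paths of \<open>F\<close>. If there are two such edges, then all members
contain this pair; on the other six edges no two members are complementary, because a pair of
edges holds no path, and \<open>card \<G> \<le> 32\<close> follows
(\<open>card_le_if_common_pair\<close>). Hence only the \<^emph>\<open>flexible\<close> edge sets,
whose paths share at most one edge, have to be considered; there are fewer than a hundred of them
in each host, most of them with at least five edges.

The second is that a class of edge sets that pairwise meet without a path contributes at most one
member. So a partition of the flexible sets into $34$ such classes proves the bound. Every
connected host with $6$ vertices and $8$ edges other than the complete bipartite graph
\<open>K\<^sub>2\<^sub>,\<^sub>4\<close> has such a partition. For
\<open>K\<^sub>2\<^sub>,\<^sub>4\<close> one first observes that one of the two inner vertices of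
a path lies on the larger side and has both its edges in the path. So two blocks of sets are
incompatible as wholes if the vertices with both edges present form complementary pairs, and
\<open>\<G>\<close> avoids one of the two. After two such alternatives the remaining sets do fall
into $34$ classes. These partitions are recorded as certificates, whose soundness is
\<open>card_le_if_certifies\<close> and which are checked by rewriting.

The hosts are classified by removing a vertex of minimum degree again and again. A minimum degree
is at most the average, so from a graph with $8$ edges on $6$ vertices one reaches graphs with at
least $6, 4, 2, 1$ edges on $5, 4, 3, 2$ vertices. Conversely every graph in question arises by
adding a vertex to a graph from the previous list, and a relabelling is recorded for each of these
extensions that turns it into a listed graph (\<open>drawing_of_dense_graph_step\<close>).\<close>

section \<open>Path-intersecting families\<close>

definition has_path :: "'a set set \<Rightarrow> bool" where
  "has_path F \<longleftrightarrow> (\<exists>a b c d. distinct [a, b, c, d] \<and> {{a, b}, {b, c}, {c, d}} \<subseteq> F)"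

lemma has_path_if_contains_P4:
  assumes "contains_P4 V F"
  shows "has_path F"
proof -
  obtain W D f where D: "D \<subseteq> F" and f: "bij_betw f P4_verts W"
    and iso: "\<forall>u\<in>P4_verts. \<forall>v\<in>P4_verts. {u, v} \<in> P4_edges \<longleftrightarrow> {f u, f v} \<in> D"
    using assms unfolding contains_P4_def is_subgraph_def graph_iso_def by blast
  have "inj_on f {0, 1, 2, 3}"
    using f by (simp add: bij_betw_def P4_verts_def)
  then have "distinct [f 0, f 1, f 2, f 3]"
    by (simp add: inj_on_def)
  moreover have "{{f 0, f 1}, {f 1, f 2}, {f 2, f 3}} \<subseteq> D"
    using iso by (auto simp: P4_verts_def P4_edges_def)
  ultimately show ?thesis
    using D unfolding has_path_def by (meson order_trans)
qed

lemma has_path_mono: "has_path F \<Longrightarrow> F \<subseteq> F' \<Longrightarrow> has_path F'"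
  unfolding has_path_def by (meson order_trans)

lemma has_pathE:
  assumes "has_path F"
  obtains a b c d where "distinct [a, b, c, d]" "{{a, b}, {b, c}, {c, d}} \<subseteq> F"
  using assms unfolding has_path_def by (elim exE conjE)

lemma not_has_path_pair:
  assumes "card D \<le> 2" "finite D"
  shows "\<not> has_path D"
proof
  assume "has_path D"
  then obtain a b c d where dist: "distinct [a, b, c, d]" and sub: "{{a, b}, {b, c}, {c, d}} \<subseteq> D"
    by (rule has_pathE)
  have ne: "{a, b} \<noteq> {b, c}" "{a, b} \<noteq> {c, d}" "{b, c} \<noteq> {c, d}"
    using dist by (auto simp add: doubleton_eq_iff)
  have 3: "card {{a, b}, {b, c}, {c, d}} = 3"
    using ne by (simp add: card_insert_if)
  have "card {{a, b}, {b, c}, {c, d}} \<le> card D"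
    by (rule card_mono[OF \<open>finite D\<close> sub])
  then show False
    unfolding 3 using assms(1) by simp
qed

definition path_intersecting :: "'a set set set \<Rightarrow> bool" where
  "path_intersecting \<G> \<longleftrightarrow> (\<forall>F\<in>\<G>. \<forall>F'\<in>\<G>. has_path (F \<inter> F'))"

text \<open>The density of a family does not change when a new edge is left free.\<close>

lemma path_intersecting_add_edge:
  assumes "finite E" "e \<notin> E" "\<G> \<subseteq> Pow E" "path_intersecting \<G>"
  defines "\<G>' \<equiv> \<G> \<union> insert e ` \<G>"
  shows "\<G>' \<subseteq> Pow (insert e E)" "path_intersecting \<G>'" "card \<G>' = 2 * card \<G>"
proof -
  show "\<G>' \<subseteq> Pow (insert e E)"
    using assms(3) by (auto simp: \<G>'_def)
  have drop: "\<exists>F\<in>\<G>. F \<subseteq> F'" if "F' \<in> \<G>'" for F'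
    using that by (auto simp: \<G>'_def)
  show "path_intersecting \<G>'"
    unfolding path_intersecting_def
  proof (intro ballI)
    fix F F' assume "F \<in> \<G>'" "F' \<in> \<G>'"
    then obtain H H' where "H \<in> \<G>" "H' \<in> \<G>" and sub: "H \<inter> H' \<subseteq> F \<inter> F'"
      using drop by (metis Int_mono)
    then show "has_path (F \<inter> F')"
      using assms(4) has_path_mono[OF _ sub] by (auto simp: path_intersecting_def)
  qed
  have "finite \<G>"
    using assms(1,3) by (meson finite_Pow_iff finite_subset)
  moreover have "\<G> \<inter> insert e ` \<G> = {}"
    using assms(2,3) by auto
  moreover have "inj_on (insert e) \<G>"
    using assms(2,3) by (intro inj_onI) (metis PowD insert_ident subset_iff)
  ultimately show "card \<G>' = 2 * card \<G>"
    by (simp add: \<G>'_def card_Un_disjoint card_image)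
qed

text \<open>Outside \<open>D\<close> no two members are complementary, since they would meet
exactly in the pair \<open>D\<close>. So the family takes up at most half of the sets that contain
\<open>D\<close>.\<close>

lemma card_le_if_common_pair:
  assumes "finite E" "D \<subseteq> E" "card D = 2" "\<G> \<subseteq> Pow E" "path_intersecting \<G>"
    and common: "\<And>F. F \<in> \<G> \<Longrightarrow> D \<subseteq> F"
  shows "8 * card \<G> \<le> 2 ^ card E"
proof -
  define S where "S = (\<union>) D ` Pow (E - D)"
  define \<phi> where "\<phi> F = D \<union> (E - F)" for F
  have [simp]: "finite E" "finite D"
    using assms(1,2) finite_subset by auto
  have fin: "finite S"
    by (simp add: S_def)
  have sub: "\<G> \<subseteq> S"
  proof
    fix F assume "F \<in> \<G>"
    then have "F = D \<union> (F - D)" "F - D \<in> Pow (E - D)"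
      using common assms(4) by auto
    then show "F \<in> S"
      unfolding S_def by blast
  qed
  have "inj_on ((\<union>) D) (Pow (E - D))"
    by (auto simp: inj_on_def)
  then have cardS: "card S = 2 ^ (card E - 2)"
    by (simp add: S_def card_image card_Pow card_Diff_subset assms(2,3))
  have sub': "\<phi> ` \<G> \<subseteq> S"
  proof
    fix F' assume "F' \<in> \<phi> ` \<G>"
    then obtain F where "F \<in> \<G>" "F' = D \<union> (E - F)"
      by (auto simp: \<phi>_def)
    moreover from this have "E - F \<in> Pow (E - D)"
      using common by blast
    ultimately show "F' \<in> S"
      unfolding S_def by blast
  qed
  have "\<G> \<inter> \<phi> ` \<G> = {}"
  proof (rule equals0I)
    fix F assume "F \<in> \<G> \<inter> \<phi> ` \<G>"
    then obtain F' where F: "F \<in> \<G>" "F' \<in> \<G>" "F = \<phi> F'"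
      by auto
    then have "F \<inter> F' = D"
      using common[OF F(2)] assms(2) by (auto simp: \<phi>_def)
    then show False
      using F assms(3,5) not_has_path_pair[of D] by (auto simp: path_intersecting_def)
  qed
  moreover have "inj_on \<phi> \<G>"
  proof (rule inj_onI)
    fix F F' assume F: "F \<in> \<G>" "F' \<in> \<G>" "\<phi> F = \<phi> F'"
    have "H = D \<union> (E - \<phi> H)" if "H \<in> \<G>" for H
      using common[OF that] that assms(2,4) by (auto simp: \<phi>_def)
    then show "F = F'"
      using F by metis
  qed
  ultimately have "2 * card \<G> = card (\<G> \<union> \<phi> ` \<G>)"
    using sub sub' fin by (simp add: card_Un_disjoint card_image finite_subset)
  also have "\<dots> \<le> 2 ^ (card E - 2)"
    using card_mono[OF fin, of "\<G> \<union> \<phi> ` \<G>"] sub sub' cardS by simp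
  finally have "8 * card \<G> \<le> 2 ^ (card E - 2) * 2 ^ 2"
    by simp
  also have "\<dots> = 2 ^ (card E - 2 + 2)"
    by (rule power_add[symmetric])
  also have "card E - 2 + 2 = card E"
    using card_mono[OF \<open>finite E\<close> assms(2)] assms(3) by simp
  finally show ?thesis .
qed

section \<open>Certificates\<close>

text \<open>An edge set of a host with a fixed list of edges is written as the list of the truth
values of membership. In \<open>hits ps m\<close> the paths of the host are \<open>ps\<close>, and
they are discarded position by position as soon as they use an edge outside \<open>m\<close>. This
keeps the intermediate lists short, which matters because all terms are evaluated by
rewriting.\<close>

fun hits :: "bool list list \<Rightarrow> bool list \<Rightarrow> bool" where
  "hits ps [] \<longleftrightarrow> ps \<noteq> []"
| "hits ps (b # m) \<longleftrightarrow>
     (if ps = [] then False else hits (if b then map tl ps else [tl p. p \<leftarrow> ps, \<not> hd p]) m)"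

lemma hits_if_fits: "p \<in> set ps \<Longrightarrow> list_all2 (\<longrightarrow>) p m \<Longrightarrow> hits ps m"
proof (induction m arbitrary: p ps)
  case (Cons b m)
  then obtain x q where q: "p = x # q" "x \<longrightarrow> b" "list_all2 (\<longrightarrow>) q m"
    by (auto simp: list_all2_Cons2)
  have "q \<in> set (if b then map tl ps else [tl p. p \<leftarrow> ps, \<not> hd p])"
    using q(1,2) Cons.prems(1) by force
  then show ?case
    using Cons.IH[OF _ q(3)] Cons.prems(1) by auto
qed auto

text \<open>The edges common to the paths \<open>ps\<close>; hosts have eight edges.\<close>

definition core :: "bool list list \<Rightarrow> bool list" where
  "core ps = foldr (map2 (\<and>)) ps (replicate 8 True)"

lemma length_core: "(\<And>p. p \<in> set ps \<Longrightarrow> length p = 8) \<Longrightarrow> length (core ps) = 8"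
  by (induction ps) (auto simp: core_def)

lemma nth_core:
  assumes "\<And>p. p \<in> set ps \<Longrightarrow> length p = 8" "i < 8"
  shows "core ps ! i \<longleftrightarrow> (\<forall>p\<in>set ps. p ! i)"
  using assms
proof (induction ps)
  case (Cons p ps)
  then have "length (core ps) = 8"
    using length_core[of ps] by auto
  then show ?case
    using Cons by (simp add: core_def)
qed (simp add: core_def)

definition flexible :: "bool list list \<Rightarrow> bool" where
  "flexible ps \<longleftrightarrow> length (filter id (core ps)) \<le> 1"

lemma common_positions_if_not_flexible:
  assumes "\<not> flexible ps" "\<And>p. p \<in> set ps \<Longrightarrow> length p = 8"
  obtains i j where "i < 8" "j < 8" "i \<noteq> j" "\<And>p. p \<in> set ps \<Longrightarrow> p ! i \<and> p ! j"
proof -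
  have "\<not> card {i. i < 8 \<and> core ps ! i} \<le> Suc 0"
    using assms(1) length_core[OF assms(2)] by (simp add: flexible_def length_filter_conv_card)
  then obtain i j where "i < 8" "j < 8" "i \<noteq> j" "core ps ! i" "core ps ! j"
    by (auto simp: card_le_Suc0_iff_eq)
  then show ?thesis
    using that nth_core[OF assms(2)] by blast
qed

text \<open>Enumerates the flexible edge sets outside \<open>ds\<close> by deciding edge after
edge whether it is present. A pair \<open>(t, p)\<close> in \<open>Q\<close> stands for a path
\<open>p\<close> that avoids all edges declared absent so far, with \<open>t\<close> its part on
the undecided edges; at a leaf the second components are precisely the paths inside the chosen
set. The branches with \<open>Q = []\<close> hold no path, and their core consists of all
edges.\<close>

fun uncovered :: "nat \<Rightarrow> (bool list \<times> bool list) list \<Rightarrow> bool list list \<Rightarrow> bool list list" where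
  "uncovered 0 Q ds = (if [] \<notin> set ds \<and> flexible (map snd Q) then [[]] else [])"
| "uncovered (Suc n) Q ds = (if Q = [] then [] else
     map (Cons True) (uncovered n [(t, p). (_ # t, p) \<leftarrow> Q] [d. True # d \<leftarrow> ds]) @
     map (Cons False) (uncovered n [(t, p). (False # t, p) \<leftarrow> Q] [d. False # d \<leftarrow> ds]))"

lemma mem_uncovered:
  assumes "length m = n" "m \<notin> set ds" "flexible [p. (t, p) \<leftarrow> Q, list_all2 (\<longrightarrow>) t m]"
    "\<And>t p. (t, p) \<in> set Q \<Longrightarrow> length t = n"
  shows "m \<in> set (uncovered n Q ds)"
  using assms
proof (induction n arbitrary: m Q ds)
  case 0
  have "\<forall>x\<in>set Q. fst x = []"
    using 0(4) by force
  then have "[p. (t, p) \<leftarrow> Q, list_all2 (\<longrightarrow>) t []] = map snd Q"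
    by (induction Q) auto
  then show ?case
    using 0 by auto
next
  case (Suc n)
  obtain b m' where m: "m = b # m'" "length m' = n"
    using Suc.prems(1) by (cases m) auto
  have "Q \<noteq> []"
    using Suc.prems(3) by (auto simp: flexible_def core_def)
  have True: "[p. (t, p) \<leftarrow> [(t, p). (_ # t, p) \<leftarrow> Q], list_all2 (\<longrightarrow>) t m'] =
      [p. (t, p) \<leftarrow> Q, list_all2 (\<longrightarrow>) t (True # m')]"
    by (induction Q) (auto split: list.split)
  have False: "[p. (t, p) \<leftarrow> [(t, p). (False # t, p) \<leftarrow> Q], list_all2 (\<longrightarrow>) t m'] =
      [p. (t, p) \<leftarrow> Q, list_all2 (\<longrightarrow>) t (False # m')]"
    by (induction Q) (auto split: list.split bool.split)
  show ?case
  proof (cases b)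
    case b: True
    have "m' \<in> set (uncovered n [(t, p). (_ # t, p) \<leftarrow> Q] [d. True # d \<leftarrow> ds])"
    proof (rule Suc.IH[OF m(2)])
      have "m' \<in> set [d. True # d \<leftarrow> ds] \<longleftrightarrow> True # m' \<in> set ds"
        by (induction ds) (auto split: list.split bool.split)
      then show "m' \<notin> set [d. True # d \<leftarrow> ds]"
        using Suc.prems(2) m b by simp
      show "flexible [p. (t, p) \<leftarrow> [(t, p). (_ # t, p) \<leftarrow> Q], list_all2 (\<longrightarrow>) t m']"
        using Suc.prems(3) unfolding True m(1) by (simp only: b)
      show "length t = n" if "(t, p) \<in> set [(t, p). (_ # t, p) \<leftarrow> Q]" for t p
        using that Suc.prems(4) by (fastforce split: list.splits)
    qed
    then show ?thesis
      using \<open>Q \<noteq> []\<close> m b by simp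
  next
    case b: False
    have "m' \<in> set (uncovered n [(t, p). (False # t, p) \<leftarrow> Q] [d. False # d \<leftarrow> ds])"
    proof (rule Suc.IH[OF m(2)])
      have "m' \<in> set [d. False # d \<leftarrow> ds] \<longleftrightarrow> False # m' \<in> set ds"
        by (induction ds) (auto split: list.split bool.split)
      then show "m' \<notin> set [d. False # d \<leftarrow> ds]"
        using Suc.prems(2) m b by simp
      show "flexible [p. (t, p) \<leftarrow> [(t, p). (False # t, p) \<leftarrow> Q], list_all2 (\<longrightarrow>) t m']"
        using Suc.prems(3) b unfolding False m(1) by simp
      show "length t = n" if "(t, p) \<in> set [(t, p). (False # t, p) \<leftarrow> Q]" for t p
        using that Suc.prems(4) by (fastforce split: list.splits bool.splits)
    qed
    then show ?thesis
      using \<open>Q \<noteq> []\<close> m b by simp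
  qed
qed

text \<open>Edge sets are abbreviated by numbers, the first edge being the least significant
digit.\<close>

fun bits :: "nat \<Rightarrow> int \<Rightarrow> bool list" where
  "bits 0 k = []"
| "bits (Suc n) k = odd k # bits n (k div 2)"

text \<open>\<open>Cover\<close> lists the classes of a partition, but only those with at least
two elements. \<open>Split A B\<close> names two blocks that are incompatible elementwise,
followed by a certificate for the families that avoid \<open>A\<close> and one for those that
avoid \<open>B\<close>.\<close>

datatype certificate =
    Cover "int list list"
  | Split "int list" "int list" certificate certificate

text \<open>The list \<open>ms\<close> collects the sets that are already known not to belong to
the family. A flexible set that occurs neither there nor in a listed class forms a class of its
own, whence the second summand.\<close>

fun certifies :: "bool list list \<Rightarrow> bool list list \<Rightarrow> certificate \<Rightarrow> bool" where
  "certifies ps ms (Cover cs) \<longleftrightarrow>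
     list_all (sorted_wrt (\<lambda>x y. \<not> hits ps (map2 (\<and>) x y))) (map (map (bits 8)) cs) \<and>
     length cs + length (uncovered 8 (map (\<lambda>p. (p, p)) ps) (ms @ map (bits 8) (concat cs))) \<le> 34"
| "certifies ps ms (Split A B c d) \<longleftrightarrow>
     list_all (\<lambda>x. list_all (\<lambda>y. \<not> hits ps (map2 (\<and>) x y)) (map (bits 8) B)) (map (bits 8) A) \<and>
     certifies ps (map (bits 8) A @ ms) c \<and> certifies ps (map (bits 8) B @ ms) d"

lemma card_le_one_if_pairwise_disjoint:
  assumes "sorted_wrt (\<lambda>x y. \<not> P x y) xs" "\<And>x y. x \<in> B \<Longrightarrow> y \<in> B \<Longrightarrow> P x y"
  shows "card (B \<inter> set xs) \<le> 1"
proof -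
  have "x = y" if "x \<in> B \<inter> set xs" "y \<in> B \<inter> set xs" for x y
    using assms that
    by (induction xs) auto
  then show ?thesis
    by (simp add: card_le_Suc0_iff_eq)
qed

text \<open>Each listed class and each uncovered set contributes at most one member, and at a
\<open>Split\<close> the family cannot meet both blocks.\<close>

lemma card_le_if_certifies:
  assumes "certifies ps ms c" "\<And>p. p \<in> set ps \<Longrightarrow> length p = 8"
    "\<And>x. x \<in> B \<Longrightarrow> length x = 8 \<and> x \<notin> set ms \<and> flexible [p \<leftarrow> ps. list_all2 (\<longrightarrow>) p x]"
    "\<And>x y. x \<in> B \<Longrightarrow> y \<in> B \<Longrightarrow> hits ps (map2 (\<and>) x y)"
  shows "card B \<le> 34"
  using assms
proof (induction c arbitrary: B ms)
  case (Cover cs)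
  define ds where "ds = map (map (bits 8)) cs"
  define rest where "rest = uncovered 8 (map (\<lambda>p. (p, p)) ps) (ms @ map (bits 8) (concat cs))"
  have *: "card (B \<inter> set C) \<le> 1" if "C \<in> set ds" for C
    using Cover.prems(1,4) that
    by (intro card_le_one_if_pairwise_disjoint[where P = "\<lambda>x y. hits ps (map2 (\<and>) x y)"])
      (auto simp: list_all_iff ds_def)
  have flex: "[p. (t, p) \<leftarrow> map (\<lambda>p. (p, p)) qs, list_all2 (\<longrightarrow>) t x] = [p \<leftarrow> qs. list_all2 (\<longrightarrow>) p x]"
    for qs x
    by (induction qs) auto
  have "x \<in> (\<Union>C\<in>set ds. B \<inter> set C) \<union> set rest" if x: "x \<in> B" for x
  proof (cases "x \<in> set (map (bits 8) (concat cs))")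
    case True
    then show ?thesis
      using x by (auto simp: ds_def)
  next
    case False
    then have "x \<in> set rest"
      using Cover.prems(2,3) x unfolding rest_def
      by (intro mem_uncovered) (simp_all only: flex, auto)
    then show ?thesis
      by blast
  qed
  then have "card B \<le> card ((\<Union>C\<in>set ds. B \<inter> set C) \<union> set rest)"
    by (intro card_mono) auto
  also have "\<dots> \<le> card (\<Union>C\<in>set ds. B \<inter> set C) + card (set rest)"
    by (rule card_Un_le)
  also have "\<dots> \<le> (\<Sum>C\<in>set ds. card (B \<inter> set C)) + length rest"
    by (intro add_mono card_UN_le card_length) auto
  also have "\<dots> \<le> card (set ds) + length rest"
    using sum_bounded_above[of "set ds" "\<lambda>C. card (B \<inter> set C)" 1] * by simp
  also have "\<dots> \<le> length cs + length rest"
    using card_length[of ds] by (simp add: ds_def)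
  also have "\<dots> \<le> 34"
    using Cover.prems(1) by (simp add: rest_def)
  finally show ?case .
next
  case (Split A B' c d)
  have "B \<inter> set (map (bits 8) A) = {} \<or> B \<inter> set (map (bits 8) B') = {}"
    using Split.prems(1,4) unfolding certifies.simps list_all_iff by blast
  then show ?case
  proof
    assume "B \<inter> set (map (bits 8) A) = {}"
    then show ?thesis
      using Split.prems by (intro Split.IH(1)[of "map (bits 8) A @ ms"]) auto
  next
    assume "B \<inter> set (map (bits 8) B') = {}"
    then show ?thesis
      using Split.prems by (intro Split.IH(2)[of "map (bits 8) B' @ ms"]) auto
  qed
qed

section \<open>Hosts as lists of pairs\<close>

definition emb :: "(nat \<Rightarrow> 'a) \<Rightarrow> nat \<times> nat \<Rightarrow> 'a set" where
  "emb f e = {f (fst e), f (snd e)}"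

text \<open>The host \<open>(V, E)\<close> is a copy of the graph on \<open>0, \<dots>, n -
1\<close> with edge list \<open>R\<close>. Pairs are increasing, so that each edge of
\<open>E\<close> comes from exactly one position of \<open>R\<close>.\<close>

definition drawing :: "nat \<Rightarrow> (nat \<times> nat) list \<Rightarrow> (nat \<Rightarrow> 'a) \<Rightarrow> 'a set \<Rightarrow> 'a set set \<Rightarrow> bool" where
  "drawing n R f V E \<longleftrightarrow> bij_betw f {..<n} V \<and> distinct R \<and> (\<forall>(a, b)\<in>set R. a < b \<and> b < n) \<and>
     E = emb f ` set R"

lemma inj_on_emb:
  assumes "inj_on f {..<n}" "\<forall>(a, b)\<in>set R. a < b \<and> b < n"
  shows "inj_on (emb f) (set R)"
proof (rule inj_onI, clarify)
  fix a b a' b' assume *: "(a, b) \<in> set R" "(a', b') \<in> set R" "emb f (a, b) = emb f (a', b')"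
  then have lt: "a < b" "a < n" "b < n" "a' < b'" "a' < n" "b' < n"
    using assms(2) by fastforce+
  have "f a = f a' \<and> f b = f b' \<or> f a = f b' \<and> f b = f a'"
    using *(3) by (simp add: emb_def doubleton_eq_iff)
  then have "a = a' \<and> b = b' \<or> a = b' \<and> b = a'"
    using lt by (simp add: inj_on_eq_iff[OF assms(1)])
  then show "a = a' \<and> b = b'"
    using lt by linarith
qed

lemma drawing_card:
  assumes "drawing n R f V E"
  shows "card E = length R"
proof -
  have "inj_on (emb f) (set R)"
    using assms by (intro inj_on_emb[of f n]) (simp_all add: drawing_def bij_betw_def)
  then show ?thesis
    using assms by (simp add: drawing_def card_image distinct_card)
qed

text \<open>A path is put together from its outer edges \<open>(a, b)\<close> and \<open>(c,
d)\<close>, taken in both directions; it arises from either end and so twice.\<close>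

definition paths :: "(nat \<times> nat) list \<Rightarrow> bool list list" where
  "paths R = (let D = R @ map prod.swap R in remdups
     (map (\<lambda>((a, b), (c, d)). map (\<lambda>e. e \<in> set [(a, b), (b, a), (b, c), (c, b), (c, d), (d, c)]) R)
       [((a, b), (c, d)) \<leftarrow> List.product D D. (b, c) \<in> set D \<and> distinct [a, b, c, d]]))"

lemma length_paths: "p \<in> set (paths R) \<Longrightarrow> length p = length R"
  by (auto simp: paths_def Let_def)

lemma mem_pathsI:
  assumes "(a, b) \<in> set (R @ map prod.swap R)" "(b, c) \<in> set (R @ map prod.swap R)"
    "(c, d) \<in> set (R @ map prod.swap R)" "distinct [a, b, c, d]"
  shows "map (\<lambda>e. e \<in> set [(a, b), (b, a), (b, c), (c, b), (c, d), (d, c)]) R \<in> set (paths R)"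
proof -
  define D where "D = R @ map prod.swap R"
  have "((a, b), (c, d)) \<in> set [((a, b), (c, d)) \<leftarrow> List.product D D. (b, c) \<in> set D \<and> distinct [a, b, c, d]]"
    using assms unfolding D_def[symmetric] by simp
  then show ?thesis
    unfolding paths_def Let_def set_remdups set_map D_def[symmetric]
    by (rule image_eqI[rotated]) (simp only: prod.case)
qed

definition trace :: "(nat \<Rightarrow> 'a) \<Rightarrow> (nat \<times> nat) list \<Rightarrow> 'a set set \<Rightarrow> bool list" where
  "trace f R F = map (\<lambda>e. emb f e \<in> F) R"

lemma nth_trace: "i < length R \<Longrightarrow> trace f R F ! i \<longleftrightarrow> emb f (R ! i) \<in> F"
  by (simp add: trace_def)

lemma trace_Int: "trace f R (F \<inter> F') = map2 (\<and>) (trace f R F) (trace f R F')"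
  by (induction R) (simp_all add: trace_def)

lemma path_in_trace_if_has_path:
  assumes dr: "drawing n R f V E" and "F \<subseteq> E" "has_path F"
  shows "\<exists>p\<in>set (paths R). list_all2 (\<longrightarrow>) p (trace f R F)"
proof -
  obtain a b c d where "distinct [a, b, c, d]" and sub: "{{a, b}, {b, c}, {c, d}} \<subseteq> F"
    using assms(3) by (rule has_pathE)
  have E: "E = emb f ` set R"
    using dr by (simp add: drawing_def)
  have edge: "\<exists>x y. (x, y) \<in> set (R @ map prod.swap R) \<and> u = f x \<and> v = f y"
    if uv: "{u, v} \<in> E" for u v
  proof -
    obtain e where "e \<in> set R" "{u, v} = {f (fst e), f (snd e)}"
      using uv unfolding E emb_def by blast
    then obtain x y where "(x, y) \<in> set R" "{u, v} = {f x, f y}"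
      by (metis prod.collapse)
    moreover from this(1) have "(y, x) \<in> prod.swap ` set R"
      by (metis image_eqI swap_simp)
    ultimately show ?thesis
      by (auto simp: doubleton_eq_iff)
  qed
  have inj: "inj_on f {..<n}" and lt: "\<And>x y. (x, y) \<in> set (R @ map prod.swap R) \<Longrightarrow> x < n \<and> y < n"
    using dr by (auto simp: drawing_def bij_betw_def)
  obtain p q where pq: "(p, q) \<in> set (R @ map prod.swap R)" "a = f p" "b = f q"
    using edge[of a b] sub assms(2) by auto
  obtain q' r where qr: "(q', r) \<in> set (R @ map prod.swap R)" "b = f q'" "c = f r"
    using edge[of b c] sub assms(2) by auto
  obtain r' s where rs: "(r', s) \<in> set (R @ map prod.swap R)" "c = f r'" "d = f s"
    using edge[of c d] sub assms(2) by auto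
  have "q' = q" "r' = r"
    using inj_onD[OF inj, of q' q] inj_onD[OF inj, of r' r] lt[OF pq(1)] lt[OF qr(1)] lt[OF rs(1)]
      pq(3) qr(2,3) rs(2) by simp_all
  define P where "P = map (\<lambda>e. e \<in> set [(p, q), (q, p), (q, r), (r, q), (r, s), (s, r)]) R"
  have "distinct [p, q, r, s]"
    using \<open>distinct [a, b, c, d]\<close> pq qr rs by auto
  then have "P \<in> set (paths R)"
    using pq(1) qr(1) rs(1) \<open>q' = q\<close> \<open>r' = r\<close> unfolding P_def
    by (intro mem_pathsI) simp_all
  moreover have "emb f e \<in> F"
    if "e \<in> set [(p, q), (q, p), (q, r), (r, q), (r, s), (s, r)]" for e
  proof -
    have "emb f e \<in> {{f p, f q}, {f q, f r}, {f r, f s}}"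
      using that unfolding list.set by (elim insertE emptyE) (simp_all add: emb_def insert_commute)
    then show ?thesis
      using sub pq(2,3) qr(3) rs(3) by auto
  qed
  then have "list_all2 (\<longrightarrow>) P (trace f R F)"
    unfolding P_def trace_def by (simp only: list_all2_map1 list_all2_map2 list_all2_same) blast
  ultimately show ?thesis
    by (rule bexI[rotated])
qed

text \<open>Either some member has two edges common to all its paths, and then these edges lie in
every member; or all members are flexible, and the certificate applies.\<close>

lemma card_le_if_certifies_drawing:
  assumes dr: "drawing n R f V E" and "card E = 8"
    and "\<G> \<subseteq> Pow E" "path_intersecting \<G>"
    and cert: "certifies (paths R) [] c"
  shows "card \<G> \<le> 34"
proof -
  have len: "length R = 8"
    using dr assms(2) by (simp add: drawing_card)
  have E: "E = emb f ` set R" and dist: "distinct R" and inj: "inj_on (emb f) (set R)"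
    using dr by (auto simp: drawing_def bij_betw_def inj_on_emb)
  have len_paths: "length p = 8" if "p \<in> set (paths R)" for p
    using length_paths[OF that] len by simp
  have meet: "\<exists>p\<in>set (paths R). list_all2 (\<longrightarrow>) p (trace f R (F \<inter> F'))"
    if "F \<in> \<G>" "F' \<in> \<G>" for F F'
    using that assms(3,4) unfolding path_intersecting_def
    by (intro path_in_trace_if_has_path[OF dr]) auto
  show ?thesis
  proof (cases "\<exists>F\<in>\<G>. \<not> flexible [p \<leftarrow> paths R. list_all2 (\<longrightarrow>) p (trace f R F)]")
    case True
    then obtain F where F: "F \<in> \<G>" "\<not> flexible [p \<leftarrow> paths R. list_all2 (\<longrightarrow>) p (trace f R F)]"
      by blast
    obtain i j where ij: "i < 8" "j < 8" "i \<noteq> j"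
      and common: "\<And>p. p \<in> set [p \<leftarrow> paths R. list_all2 (\<longrightarrow>) p (trace f R F)] \<Longrightarrow> p ! i \<and> p ! j"
      using common_positions_if_not_flexible[OF F(2)] len_paths by (metis filter_is_subset subsetD)
    define D where "D = {emb f (R ! i), emb f (R ! j)}"
    have "R ! i \<in> set R" "R ! j \<in> set R" "R ! i \<noteq> R ! j"
      using len dist ij by (simp_all add: nth_eq_iff_index_eq)
    then have "D \<subseteq> E" "card D = 2"
      using inj by (auto simp: D_def E inj_on_eq_iff)
    moreover have "D \<subseteq> F'" if F': "F' \<in> \<G>" for F'
    proof -
      obtain p where p: "p \<in> set (paths R)" "list_all2 (\<longrightarrow>) p (trace f R (F \<inter> F'))"
        using meet[OF F(1) F'] by blast
      have imp: "p ! k \<longrightarrow> emb f (R ! k) \<in> F \<and> emb f (R ! k) \<in> F'" if "k < 8" for k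
        using list_all2_nthD2[OF p(2), of k] that len by (simp add: nth_trace) (simp add: trace_def)
      have "list_all2 (\<longrightarrow>) p (trace f R F)"
        using imp len_paths[OF p(1)] len by (simp add: list_all2_conv_all_nth nth_trace) (simp add: trace_def)
      then have "p ! i \<and> p ! j"
        using common p(1) by simp
      then show ?thesis
        using imp ij by (simp add: D_def)
    qed
    ultimately have "8 * card \<G> \<le> 2 ^ card E"
      using assms(3,4) by (intro card_le_if_common_pair[of E D]) (simp_all add: E)
    then show ?thesis
      by (simp add: assms(2))
  next
    case False
    have "inj_on (trace f R) \<G>"
    proof (rule inj_onI)
      fix F F' assume FF': "F \<in> \<G>" "F' \<in> \<G>" "trace f R F = trace f R F'"
      have "emb f e \<in> F \<longleftrightarrow> emb f e \<in> F'" if "e \<in> set R" for e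
        using FF'(3) that by (simp add: trace_def)
      then have "x \<in> F \<longleftrightarrow> x \<in> F'" if "x \<in> E" for x
        using that unfolding E by blast
      then show "F = F'"
        using FF' assms(3) by blast
    qed
    then have "card \<G> = card (trace f R ` \<G>)"
      by (simp add: card_image)
    also have "\<dots> \<le> 34"
    proof (rule card_le_if_certifies[OF cert len_paths])
      show "length x = 8 \<and> x \<notin> set [] \<and> flexible [p \<leftarrow> paths R. list_all2 (\<longrightarrow>) p x]"
        if "x \<in> trace f R ` \<G>" for x
        using that False len by (auto simp: trace_def)
      show "hits (paths R) (map2 (\<and>) x y)" if "x \<in> trace f R ` \<G>" "y \<in> trace f R ` \<G>" for x y
        using that meet hits_if_fits by (fastforce simp flip: trace_Int)
    qed
    finally show ?thesis .
  qed
qed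

section \<open>Classification of the hosts\<close>

text \<open>Vertex \<open>x\<close> of the new graph is vertex \<open>\<tau> ! x\<close> of the
old one. The result is sorted, so that equal graphs are equal lists.\<close>

definition relabel :: "nat list \<Rightarrow> (nat \<times> nat) list \<Rightarrow> (nat \<times> nat) list" where
  "relabel \<tau> G = (let is = [0..<length \<tau>] in
     [(x, y) \<leftarrow> List.product is is. x < y \<and> ((\<tau> ! x, \<tau> ! y) \<in> set G \<or> (\<tau> ! y, \<tau> ! x) \<in> set G)])"

lemma distinct_relabel: "distinct (relabel \<tau> G)"
  by (simp add: relabel_def Let_def distinct_product)

lemma mem_relabel_iff:
  "(x, y) \<in> set (relabel \<tau> G) \<longleftrightarrow>
     x < y \<and> y < length \<tau> \<and> ((\<tau> ! x, \<tau> ! y) \<in> set G \<or> (\<tau> ! y, \<tau> ! x) \<in> set G)"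
  by (auto simp: relabel_def Let_def)

lemma drawing_relabel:
  assumes dr: "drawing n G f V E" and \<tau>: "length \<tau> = n" "distinct \<tau>" "set \<tau> \<subseteq> {..<n}"
  shows "drawing n (relabel \<tau> G) (\<lambda>x. f (\<tau> ! x)) V E"
proof -
  have lt: "a < b \<and> b < n" if "(a, b) \<in> set G" for a b
    using dr that by (auto simp: drawing_def)
  have set_eq: "set \<tau> = {..<n}"
    using \<tau> by (intro card_subset_eq) (simp_all add: distinct_card)
  have "bij_betw ((!) \<tau>) {..<n} {..<n}"
    using bij_betw_nth[OF \<tau>(2)] \<tau>(1) set_eq by simp
  then have bij: "bij_betw (f \<circ> (!) \<tau>) {..<n} V"
    using dr unfolding drawing_def by (intro bij_betw_trans) auto
  have "E = emb (\<lambda>x. f (\<tau> ! x)) ` set (relabel \<tau> G)"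
  proof (intro equalityI subsetI)
    fix e assume "e \<in> E"
    then obtain p where "p \<in> set G" "e = {f (fst p), f (snd p)}"
      using dr unfolding drawing_def emb_def by blast
    then obtain a b where ab: "(a, b) \<in> set G" "e = {f a, f b}"
      by (metis prod.collapse)
    have "a < n" "b < n" "a \<noteq> b"
      using lt[OF ab(1)] by auto
    then have "a \<in> set \<tau>" "b \<in> set \<tau>"
      by (simp_all add: set_eq)
    then obtain x y where xy: "x < n" "y < n" "\<tau> ! x = a" "\<tau> ! y = b"
      using \<tau>(1) by (metis in_set_conv_nth)
    then have "x < y \<or> y < x"
      using \<open>a \<noteq> b\<close> by (metis nat_neq_iff)
    then have "(x, y) \<in> set (relabel \<tau> G) \<or> (y, x) \<in> set (relabel \<tau> G)"
      using xy ab(1) \<tau>(1) by (auto simp: mem_relabel_iff)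
    moreover have "emb (\<lambda>x. f (\<tau> ! x)) (x, y) = e" "emb (\<lambda>x. f (\<tau> ! x)) (y, x) = e"
      using xy ab(2) by (auto simp: emb_def)
    ultimately show "e \<in> emb (\<lambda>x. f (\<tau> ! x)) ` set (relabel \<tau> G)"
      by (metis imageI)
  next
    fix e assume "e \<in> emb (\<lambda>x. f (\<tau> ! x)) ` set (relabel \<tau> G)"
    then obtain x y where xy: "(x, y) \<in> set (relabel \<tau> G)" "e = emb (\<lambda>x. f (\<tau> ! x)) (x, y)"
      by (metis imageE prod.collapse)
    have "emb f (\<tau> ! x, \<tau> ! y) = e" "emb f (\<tau> ! y, \<tau> ! x) = e"
      using xy(2) by (auto simp: emb_def)
    then show "e \<in> E"
      using xy(1) dr unfolding drawing_def mem_relabel_iff by (metis imageI)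
  qed
  moreover have "\<forall>(a, b)\<in>set (relabel \<tau> G). a < b \<and> b < n"
    using \<tau>(1) by (auto simp: mem_relabel_iff)
  ultimately show ?thesis
    using bij distinct_relabel unfolding drawing_def comp_def by blast
qed

lemma extend_drawing:
  assumes graph: "is_graph V E" and v: "v \<in> V" and dr: "drawing n R f (V - {v}) {e \<in> E. v \<notin> e}"
  shows "drawing (Suc n) (R @ map (\<lambda>u. (u, n)) [u \<leftarrow> [0..<n]. {f u, v} \<in> E]) (f(n := v)) V E"
proof -
  define N where "N = [u \<leftarrow> [0..<n]. {f u, v} \<in> E]"
  define g where "g = f(n := v)"
  have bij: "bij_betw f {..<n} (V - {v})" and R: "distinct R" "\<And>a b. (a, b) \<in> set R \<Longrightarrow> a < b \<and> b < n"
    and old: "{e \<in> E. v \<notin> e} = emb f ` set R"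
    using dr by (auto simp: drawing_def)
  have "bij_betw g {..<n} (V - {v})"
    using bij by (subst bij_betw_cong[of _ _ f]) (auto simp: g_def)
  then have "bij_betw g ({..<n} \<union> {n}) ((V - {v}) \<union> {g n})"
    by (intro notIn_Un_bij_betw) (auto simp: g_def)
  moreover have "{..<n} \<union> {n} = {..<Suc n}" "(V - {v}) \<union> {g n} = V"
    using v by (auto simp: g_def)
  ultimately have bij': "bij_betw g {..<Suc n} V"
    by simp
  have emb_old: "emb g e = emb f e" if "e \<in> set R" for e
    using R(2)[of "fst e" "snd e"] that by (simp add: emb_def g_def)
  have emb_new: "emb g (u, n) = {f u, v}" if "u < n" for u
    using that by (simp add: emb_def g_def)
  have "{e \<in> E. v \<in> e} = (\<lambda>u. {f u, v}) ` set N"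
  proof (intro equalityI subsetI)
    fix e assume e: "e \<in> {e \<in> E. v \<in> e}"
    then have "e \<subseteq> V" "card e = 2"
      using graph by (auto simp: is_graph_def)
    then obtain w where w: "e = {w, v}" "w \<noteq> v"
      using e by (auto simp: card_2_iff)
    then have "w \<in> f ` {..<n}"
      using \<open>e \<subseteq> V\<close> bij by (auto simp: bij_betw_def)
    then obtain u where "u < n" "w = f u"
      by auto
    then have "u \<in> set N"
      using e w by (simp add: N_def)
    then show "e \<in> (\<lambda>u. {f u, v}) ` set N"
      using w \<open>w = f u\<close> by blast
  qed (auto simp: N_def)
  also have "\<dots> = emb g ` (\<lambda>u. (u, n)) ` set N"
    unfolding image_image by (intro image_cong) (auto simp: N_def emb_new)
  finally have new: "{e \<in> E. v \<in> e} = emb g ` (\<lambda>u. (u, n)) ` set N" .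
  have "{e \<in> E. v \<notin> e} = emb g ` set R"
    unfolding old using emb_old by (intro image_cong) auto
  moreover have "E = {e \<in> E. v \<notin> e} \<union> {e \<in> E. v \<in> e}"
    by blast
  ultimately have "E = emb g ` set (R @ map (\<lambda>u. (u, n)) N)"
    unfolding set_append set_map image_Un using new by simp
  moreover have "distinct (R @ map (\<lambda>u. (u, n)) N)"
    using R by (auto simp: N_def distinct_map inj_on_def)
  moreover have "\<forall>(a, b)\<in>set (R @ map (\<lambda>u. (u, n)) N). a < b \<and> b < Suc n"
    using R(2) by (fastforce simp: N_def)
  ultimately show ?thesis
    using bij' unfolding drawing_def N_def g_def by blast
qed

definition degree :: "(nat \<times> nat) list \<Rightarrow> nat \<Rightarrow> nat" where
  "degree G u = length [(a, b) \<leftarrow> G. a = u \<or> b = u]"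

lemma card_incident_le_degree:
  assumes dr: "drawing n G f V E" and "u < n"
  shows "card {e \<in> E. f u \<in> e} \<le> degree G u"
proof -
  have inj: "inj_on f {..<n}" and lt: "\<And>a b. (a, b) \<in> set G \<Longrightarrow> a < b \<and> b < n"
    using dr by (auto simp: drawing_def bij_betw_def)
  have "{e \<in> E. f u \<in> e} \<subseteq> emb f ` set [(a, b) \<leftarrow> G. a = u \<or> b = u]"
  proof
    fix e assume e: "e \<in> {e \<in> E. f u \<in> e}"
    then have "e \<in> emb f ` set G"
      using dr by (simp add: drawing_def)
    then obtain a b where ab: "(a, b) \<in> set G" "e = emb f (a, b)"
      by (metis imageE prod.collapse)
    then have "f u = f a \<or> f u = f b"
      using e by (auto simp: emb_def)
    then have "a = u \<or> b = u"
      using lt[OF ab(1)] \<open>u < n\<close> inj_on_eq_iff[OF inj] by auto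
    then show "e \<in> emb f ` set [(a, b) \<leftarrow> G. a = u \<or> b = u]"
      using ab by auto
  qed
  then have "card {e \<in> E. f u \<in> e} \<le> card (emb f ` set [(a, b) \<leftarrow> G. a = u \<or> b = u])"
    by (intro card_mono) auto
  also have "\<dots> \<le> degree G u"
    unfolding degree_def by (meson card_image_le card_length List.finite_set order_trans)
  finally show ?thesis .
qed

lemma sum_card_incident:
  assumes "is_graph V E"
  shows "(\<Sum>v\<in>V. card {e \<in> E. v \<in> e}) = 2 * card E"
proof -
  have "finite V" "finite E"
    using assms finite_subset[of E "Pow V"] by (auto simp: is_graph_def)
  moreover have "card {v \<in> V. v \<in> e} = 2" if "e \<in> E" for e
  proof -
    have "{v \<in> V. v \<in> e} = e"
      using assms that by (auto simp: is_graph_def)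
    then show ?thesis
      using assms that by (simp add: is_graph_def)
  qed
  ultimately show ?thesis
    using sum_multicount_gen[of V E "\<lambda>v e. v \<in> e" "\<lambda>_. 2"] by simp
qed

lemma filter_mem_subseqs: "filter P xs \<in> set (subseqs xs)"
  by (induction xs) (auto simp: Let_def)

text \<open>Up to isomorphism, entry \<open>n \<le> 5\<close> contains the graphs on
\<open>n\<close> vertices with at least \<open>min_size ! n\<close> edges, and entry
\<open>6\<close> the graphs on six vertices with exactly eight edges and no isolated
vertex.\<close>

definition dense_graphs :: "(nat \<times> nat) list list list" where
  "dense_graphs = [
    [[]],
    [[]],
    [[(0, 1)]],
    [[(0, 1), (0, 2), (1, 2)], [(0, 1), (0, 2)]],
    [[(0, 1), (0, 2), (0, 3), (1, 2), (1, 3), (2, 3)], [(0, 1), (0, 2), (0, 3), (1, 2), (1, 3)],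
     [(0, 1), (0, 2), (0, 3), (1, 2)], [(0, 1), (0, 2), (1, 3), (2, 3)]],
    [[(0, 1), (0, 2), (0, 3), (0, 4), (1, 2), (1, 3), (1, 4), (2, 3), (2, 4), (3, 4)],
     [(0, 1), (0, 2), (0, 3), (0, 4), (1, 2), (1, 3), (1, 4), (2, 3), (2, 4)],
     [(0, 1), (0, 2), (0, 3), (0, 4), (1, 2), (1, 3), (1, 4), (2, 3)],
     [(0, 1), (0, 2), (0, 3), (0, 4), (1, 2), (1, 3), (2, 3)],
     [(0, 1), (0, 2), (0, 3), (1, 2), (1, 3), (2, 3)],
     [(0, 1), (0, 2), (0, 3), (0, 4), (1, 2), (1, 3), (1, 4)],
     [(0, 1), (0, 2), (0, 3), (0, 4), (1, 2), (1, 3), (2, 4), (3, 4)],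
     [(0, 1), (0, 2), (0, 3), (0, 4), (1, 2), (1, 3), (2, 4)],
     [(0, 1), (0, 2), (0, 3), (0, 4), (1, 2), (1, 3)],
     [(0, 1), (0, 2), (0, 3), (1, 2), (1, 3), (2, 4), (3, 4)],
     [(0, 1), (0, 2), (0, 3), (1, 2), (1, 3), (2, 4)],
     [(0, 1), (0, 2), (0, 3), (0, 4), (1, 2), (3, 4)],
     [(0, 1), (0, 2), (0, 3), (1, 2), (1, 4), (3, 4)],
     [(0, 1), (0, 2), (0, 4), (1, 3), (2, 3), (3, 4)]],
    [[(0, 1), (0, 2), (0, 3), (0, 4), (0, 5), (1, 2), (1, 3), (2, 3)],
     [(0, 1), (0, 2), (0, 3), (0, 4), (1, 2), (1, 3), (1, 5), (2, 3)],
     [(0, 1), (0, 2), (0, 3), (0, 4), (1, 2), (1, 3), (2, 3), (4, 5)],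
     [(0, 1), (0, 2), (0, 3), (0, 4), (0, 5), (1, 2), (1, 3), (1, 4)],
     [(0, 1), (0, 2), (0, 3), (0, 4), (1, 2), (1, 3), (1, 4), (2, 5)],
     [(0, 1), (0, 2), (0, 3), (0, 4), (0, 5), (1, 2), (1, 3), (2, 4)],
     [(0, 1), (0, 2), (0, 3), (0, 4), (1, 2), (1, 3), (1, 5), (2, 4)],
     [(0, 1), (0, 2), (0, 3), (0, 4), (1, 2), (1, 3), (2, 4), (3, 5)],
     [(0, 1), (0, 2), (0, 3), (0, 4), (0, 5), (1, 2), (1, 3), (4, 5)],
     [(0, 1), (0, 2), (0, 3), (0, 4), (1, 2), (1, 3), (1, 5), (4, 5)],
     [(0, 1), (0, 2), (0, 3), (0, 4), (1, 2), (1, 3), (2, 5), (4, 5)],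
     [(0, 1), (0, 2), (0, 3), (0, 5), (1, 2), (1, 3), (2, 4), (3, 4)],
     [(0, 1), (0, 2), (0, 3), (1, 2), (1, 3), (2, 4), (2, 5), (3, 4)],
     [(0, 1), (0, 2), (0, 3), (1, 2), (1, 3), (2, 4), (3, 4), (4, 5)],
     [(0, 1), (0, 2), (0, 3), (1, 2), (1, 3), (2, 4), (2, 5), (4, 5)],
     [(0, 1), (0, 2), (0, 3), (1, 2), (1, 3), (2, 4), (3, 5), (4, 5)],
     [(0, 1), (0, 2), (0, 3), (0, 4), (1, 2), (1, 5), (3, 4), (3, 5)],
     [(0, 1), (0, 2), (0, 3), (0, 5), (1, 2), (1, 4), (3, 4), (4, 5)],
     [(0, 1), (0, 2), (0, 3), (1, 2), (1, 4), (2, 5), (3, 4), (3, 5)],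
     [(0, 1), (0, 2), (0, 3), (1, 2), (1, 4), (3, 4), (3, 5), (4, 5)],
     [(0, 1), (0, 2), (0, 4), (0, 5), (1, 3), (2, 3), (3, 4), (3, 5)],
     [(0, 1), (0, 2), (0, 4), (1, 3), (1, 5), (2, 3), (2, 5), (3, 4)]]]"

text \<open>Read from right to left, each number \<open>s\<close> at position \<open>n + 1\<close>
gives the next one as \<open>s - \<lfloor>2 * s / (n + 1)\<rfloor>\<close>, where \<open>2 * s /
(n + 1)\<close> is the average degree.\<close>

definition min_size :: "nat list" where
  "min_size = [0, 0, 1, 2, 4, 6, 8]"

definition add_vertex :: "nat \<Rightarrow> (nat \<times> nat) list \<Rightarrow> nat list \<Rightarrow> (nat \<times> nat) list" where
  "add_vertex n R N = R @ map (\<lambda>u. (u, n)) N"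

text \<open>The conditions on the new vertex \<open>n\<close>, with neighbours \<open>N\<close>,
say that it has minimum degree in the extended graph, and that the latter belongs to the class
under consideration.\<close>

definition admissible :: "nat \<Rightarrow> (nat \<times> nat) list \<Rightarrow> nat list \<Rightarrow> bool" where
  "admissible n R N \<longleftrightarrow> min_size ! Suc n \<le> length R + length N \<and>
     (n = 5 \<longrightarrow> length R + length N = 8 \<and> N \<noteq> []) \<and>
     list_all (\<lambda>u. length N \<le> degree (add_vertex n R N) u) [0..<n]"

definition extensions :: "nat \<Rightarrow> (nat \<times> nat) list list" where
  "extensions n = map (\<lambda>(R, N). add_vertex n R N)
     [(R, N) \<leftarrow> List.product (dense_graphs ! n) (subseqs [0..<n]). admissible n R N]"

text \<open>Entry \<open>n\<close> runs parallel to \<open>extensions n\<close>.\<close>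

definition relabellings :: "nat list list list" where
  "relabellings = [
    [[0]],
    [[0, 1]],
    [[0, 1, 2], [0, 1, 2], [1, 0, 2]],
    [[0, 1, 2, 3], [0, 1, 2, 3], [0, 2, 1, 3], [0, 1, 2, 3], [1, 2, 0, 3], [1, 0, 2, 3],
     [2, 0, 1, 3], [0, 1, 2, 3]],
    [[0, 1, 2, 3, 4], [0, 1, 2, 3, 4], [0, 1, 3, 2, 4], [0, 1, 2, 3, 4], [0, 2, 3, 1, 4],
     [0, 2, 1, 3, 4], [0, 3, 1, 2, 4], [0, 1, 2, 3, 4], [1, 2, 3, 0, 4], [1, 2, 0, 3, 4],
     [1, 3, 0, 2, 4], [1, 0, 2, 3, 4], [2, 3, 0, 1, 4], [2, 0, 1, 3, 4], [3, 0, 1, 2, 4],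
     [0, 1, 2, 3, 4], [0, 1, 2, 3, 4], [0, 1, 2, 3, 4], [0, 1, 2, 3, 4], [0, 1, 3, 2, 4],
     [0, 1, 2, 3, 4], [1, 0, 2, 3, 4], [1, 0, 2, 3, 4], [1, 0, 3, 2, 4], [1, 0, 2, 3, 4],
     [0, 1, 2, 3, 4], [0, 1, 2, 3, 4], [0, 1, 3, 2, 4], [0, 1, 2, 3, 4], [0, 1, 2, 3, 4],
     [0, 2, 1, 3, 4], [0, 1, 4, 2, 3], [0, 2, 4, 1, 3], [0, 1, 2, 3, 4], [1, 0, 3, 2, 4],
     [1, 3, 4, 0, 2], [2, 3, 4, 0, 1]],
    [[0, 1, 2, 3, 4, 5], [0, 1, 2, 3, 4, 5], [0, 2, 1, 3, 4, 5], [0, 3, 1, 2, 4, 5],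
     [0, 1, 2, 3, 4, 5], [0, 1, 2, 3, 4, 5], [1, 0, 2, 3, 4, 5], [0, 1, 2, 3, 4, 5],
     [0, 1, 3, 2, 4, 5], [0, 1, 4, 2, 3, 5], [0, 1, 2, 3, 4, 5], [0, 1, 2, 3, 4, 5],
     [0, 2, 1, 4, 3, 5], [0, 1, 2, 3, 4, 5], [0, 2, 1, 4, 3, 5], [0, 1, 2, 3, 4, 5],
     [0, 1, 2, 3, 4, 5], [0, 1, 2, 3, 4, 5], [0, 1, 3, 2, 4, 5], [0, 1, 2, 3, 4, 5],
     [1, 0, 2, 3, 4, 5], [0, 1, 2, 3, 4, 5], [0, 1, 3, 2, 4, 5], [0, 1, 2, 3, 4, 5],
     [0, 1, 2, 3, 5, 4], [1, 0, 2, 3, 5, 4], [0, 1, 2, 3, 4, 5], [0, 1, 2, 3, 4, 5],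
     [0, 1, 2, 5, 3, 4], [0, 2, 1, 5, 3, 4], [0, 3, 4, 5, 1, 2], [0, 4, 3, 5, 1, 2],
     [1, 2, 0, 5, 3, 4], [0, 1, 2, 3, 4, 5], [0, 1, 2, 4, 3, 5], [0, 2, 1, 3, 4, 5],
     [0, 2, 1, 4, 3, 5], [3, 4, 0, 5, 1, 2], [0, 1, 2, 5, 3, 4], [0, 2, 1, 5, 3, 4],
     [0, 1, 2, 3, 5, 4], [0, 1, 2, 3, 4, 5], [1, 2, 0, 5, 4, 3], [1, 0, 2, 4, 3, 5],
     [1, 0, 2, 4, 5, 3], [0, 1, 2, 3, 4, 5], [1, 0, 2, 4, 3, 5], [0, 1, 2, 3, 4, 5],
     [0, 1, 5, 2, 3, 4], [0, 2, 5, 1, 3, 4], [0, 1, 2, 3, 4, 5], [0, 4, 5, 1, 3, 2],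
     [0, 1, 2, 3, 4, 5], [3, 1, 5, 2, 0, 4], [0, 1, 4, 3, 2, 5], [3, 2, 5, 1, 0, 4],
     [0, 2, 4, 3, 1, 5], [3, 4, 5, 1, 0, 2]]]"

definition recognised :: "nat \<Rightarrow> (nat \<times> nat) list \<Rightarrow> nat list \<Rightarrow> bool" where
  "recognised n G \<tau> \<longleftrightarrow> length \<tau> = n \<and> distinct \<tau> \<and> list_all (\<lambda>x. x < n) \<tau> \<and>
     relabel \<tau> G \<in> set (dense_graphs ! n)"

lemma extensions_recognised:
  "list_all (\<lambda>n. list_all2 (recognised (Suc n)) (extensions n) (relabellings ! n)) [0..<6]"
  by code_simp

lemma ex_list_all2_partner: "list_all2 P xs ys \<Longrightarrow> x \<in> set xs \<Longrightarrow> \<exists>y. P x y"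
  by (induction rule: list_all2_induct) auto

text \<open>Removing a vertex of minimum degree leaves a graph to which the assumption
\<open>IH\<close> applies, because the minimum degree is at most the average; putting the vertex
back gives one of the \<open>extensions\<close>.\<close>

lemma drawing_of_dense_graph_step:
  assumes "n < 6" "is_graph V E" "card V = Suc n" "min_size ! Suc n \<le> card E"
    and last: "n = 5 \<Longrightarrow> card E = 8 \<and> (\<forall>v\<in>V. \<exists>e\<in>E. v \<in> e)"
    and IH: "\<And>V' E'. is_graph V' E' \<Longrightarrow> card V' = n \<Longrightarrow> min_size ! n \<le> card E' \<Longrightarrow>
      \<exists>R\<in>set (dense_graphs ! n). \<exists>f :: nat \<Rightarrow> 'a. drawing n R f V' E'"
  shows "\<exists>R\<in>set (dense_graphs ! Suc n). \<exists>f :: nat \<Rightarrow> 'a. drawing (Suc n) R f V E"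
proof -
  define deg where "deg v = card {e \<in> E. v \<in> e}" for v
  have fin: "finite V" "finite E"
    using assms(2) finite_subset[of E "Pow V"] by (auto simp: is_graph_def)
  have "V \<noteq> {}"
    using assms(3) by auto
  then obtain v where v: "v \<in> V" and least: "\<And>u. u \<in> V \<Longrightarrow> deg v \<le> deg u"
    using ex_min_if_finite[of "deg ` V"] fin(1) by (fastforce simp: not_less)
  have "Suc n * deg v \<le> (\<Sum>u\<in>V. deg u)"
    using sum_bounded_below[of V "deg v" deg] least assms(3) by simp
  then have deg: "Suc n * deg v \<le> 2 * card E"
    using sum_card_incident[OF assms(2)] by (simp add: deg_def)
  define E' where "E' = {e \<in> E. v \<notin> e}"
  have "card E = card (E' \<union> {e \<in> E. v \<in> e})"
    by (rule arg_cong[of _ _ card]) (auto simp: E'_def)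
  then have card_E: "card E = card E' + deg v"
    using fin(2) unfolding deg_def E'_def by (subst (asm) card_Un_disjoint) auto
  have "is_graph (V - {v}) E'"
    using assms(2) by (auto simp: is_graph_def E'_def)
  moreover have "card (V - {v}) = n"
    using assms(3) v by simp
  moreover have "min_size ! n \<le> card E'"
  proof -
    \<comment> \<open>The average bound \<open>deg\<close> gives the recursion behind \<open>min_size\<close>.\<close>
    have "n = 0 \<or> n = 1 \<or> n = 2 \<or> n = 3 \<or> n = 4 \<or> n = 5"
      using \<open>n < 6\<close> by linarith
    then show ?thesis
      using deg card_E assms(4) by (elim disjE) (simp_all add: min_size_def)
  qed
  ultimately obtain R f where R: "R \<in> set (dense_graphs ! n)" and dr: "drawing n R f (V - {v}) E'"
    using IH by blast
  define N where "N = [u \<leftarrow> [0..<n]. {f u, v} \<in> E]"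
  have dr': "drawing (Suc n) (add_vertex n R N) (f(n := v)) V E"
    unfolding add_vertex_def N_def using dr unfolding E'_def
    by (rule extend_drawing[OF assms(2) v])
  have len: "length R + length N = card E" "length N = deg v"
    using drawing_card[OF dr] drawing_card[OF dr'] card_E by (simp_all add: add_vertex_def)
  have "length N \<le> degree (add_vertex n R N) u" if "u < n" for u
  proof -
    have "(f(n := v)) u \<in> V"
      using dr' that by (auto simp: drawing_def bij_betw_def)
    then have "deg v \<le> card {e \<in> E. (f(n := v)) u \<in> e}"
      using least unfolding deg_def by blast
    also have "\<dots> \<le> degree (add_vertex n R N) u"
      using that by (intro card_incident_le_degree[OF dr']) simp
    finally show ?thesis
      by (simp add: len)
  qed
  moreover have "N \<noteq> []" if "n = 5"
  proof -
    have "deg v \<noteq> 0"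
      using last[OF that] v fin(2) by (auto simp: deg_def)
    then show ?thesis
      using len by auto
  qed
  ultimately have "admissible n R N"
    using last assms(4) unfolding admissible_def len(1) by (simp add: list_all_iff)
  moreover have "N \<in> set (subseqs [0..<n])"
    unfolding N_def by (rule filter_mem_subseqs)
  ultimately have ext: "add_vertex n R N \<in> set (extensions n)"
    using R by (force simp: extensions_def)
  have "list_all2 (recognised (Suc n)) (extensions n) (relabellings ! n)"
    using extensions_recognised \<open>n < 6\<close> unfolding list_all_iff by simp
  from ex_list_all2_partner[OF this ext] obtain \<tau> where \<tau>: "recognised (Suc n) (add_vertex n R N) \<tau>"
    by blast
  then have "set \<tau> \<subseteq> {..<Suc n}"
    by (auto simp: recognised_def list_all_iff)
  then have "drawing (Suc n) (relabel \<tau> (add_vertex n R N)) (\<lambda>x. (f(n := v)) (\<tau> ! x)) V E"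
    using \<tau> by (intro drawing_relabel[OF dr']) (simp_all add: recognised_def)
  moreover have "relabel \<tau> (add_vertex n R N) \<in> set (dense_graphs ! Suc n)"
    using \<tau> by (simp add: recognised_def)
  ultimately show ?thesis
    by blast
qed

lemma drawing_of_dense_graph:
  assumes "n \<le> 5" "is_graph V E" "card V = n" "min_size ! n \<le> card E"
  shows "\<exists>R\<in>set (dense_graphs ! n). \<exists>f :: nat \<Rightarrow> 'a. drawing n R f V E"
  using assms
proof (induction n arbitrary: V E)
  case 0
  then have "V = {}" "E = {}"
    by (auto simp: is_graph_def)
  then have "drawing 0 [] (\<lambda>_. undefined) V E"
    by (simp add: drawing_def bij_betw_def)
  then show ?case
    by (auto simp: dense_graphs_def)
next
  case (Suc n)
  then show ?case
    by (intro drawing_of_dense_graph_step[of n]) auto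
qed

section \<open>The bound for eight edges\<close>

text \<open>The certificates for the graphs \<open>dense_graphs ! 6\<close>, in this order. The
only one with \<open>Split\<close> belongs to \<open>K\<^sub>2\<^sub>,\<^sub>4\<close> with
smaller side \<open>{0, 3}\<close>: its blocks consist of the flexible sets in which, on the
larger side, precisely the vertices of \<open>{1, 2}\<close> or of \<open>{4, 5}\<close>,
respectively of \<open>{1, 4}\<close> or of \<open>{2, 5}\<close>, keep both their edges.\<close>

definition certificates :: "certificate list" where
  "certificates = [
    Cover [[47, 243, 244], [55, 235, 236], [59, 93, 158, 231], [63, 223], [79, 242, 245], [87, 234, 237],
      [95, 191], [102, 165, 195], [103, 187, 221], [107, 183, 206], [109, 174, 215],
      [110, 173, 203], [111, 179, 213], [115, 175, 214], [117, 182, 207], [118, 181, 211],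
      [119, 171, 205], [121, 186, 220, 227], [123, 167, 222], [125, 190, 199], [126, 189, 219],
      [127, 159], [143, 241, 246], [151, 233, 238], [249, 254], [250, 253], [251, 252]],
    Cover [[31, 239], [47, 223], [54, 149, 163, 218], [55, 173, 219], [59, 215, 238], [61, 222, 231],
      [62, 157, 235], [63, 207], [87, 187, 252], [91, 183, 236], [93, 230], [95, 175, 244],
      [103, 189, 250], [107, 181, 186], [109, 151, 234], [111, 159, 242], [115, 253], [117, 251],
      [118, 213, 227], [119, 249], [123, 174, 245], [125, 158, 243], [126, 171, 221],
      [127, 143, 241], [155, 182, 237], [167, 188, 217], [179, 205, 214], [185, 199, 254],
      [190, 211, 229], [203, 246], [220, 233]],
    Cover [[31, 239], [47, 223], [54, 85, 235], [55, 109, 219], [59, 117, 238], [61, 115, 222],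
      [62, 99, 221], [63, 207], [79, 191], [87, 110, 187], [91, 118, 237], [93, 107, 190],
      [94, 103, 189], [95, 175], [111, 159], [119, 155], [121, 183, 203, 220], [122, 171, 188, 215],
      [123, 174], [124, 186, 217, 231], [125, 158], [126, 157], [173, 247], [182, 213, 227],
      [205, 243], [206, 245], [233, 246], [249, 254], [250, 253], [251, 252]],
    Cover [[47, 206, 211], [55, 87, 157, 234], [59, 217, 230], [63, 223], [79, 174, 213], [93, 186],
      [95, 191], [102, 170, 221], [103, 187, 204], [107, 183, 252], [109, 215, 250],
      [110, 143, 185], [111, 179], [115, 175], [117, 207], [119, 171, 205], [121, 238],
      [123, 167, 222], [125, 190, 199], [126, 189, 203], [127, 159], [155, 236], [173, 219, 246],
      [181, 254], [227, 253], [229, 251], [231, 249], [233, 247], [235, 245], [237, 243]],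
    Cover [[31, 239, 242], [47, 223], [54, 90, 236], [55, 219, 237], [59, 124, 215], [61, 231, 250],
      [62, 211, 234], [63, 207, 248], [79, 191], [87, 110, 187], [91, 109, 183], [93, 235, 246],
      [94, 185, 199], [95, 175, 244], [103, 189, 222], [107, 190, 221], [108, 182, 218], [111, 159],
      [115, 158, 253], [117, 251], [118, 155, 220], [119, 206, 249], [121, 247], [122, 167, 181],
      [123, 174, 245], [125, 243], [126, 171, 213], [151, 252], [179, 238], [186, 214],
      [188, 203, 217, 230]],
    Cover [[47, 214, 241], [55, 222, 235], [59, 221, 231], [63, 223], [79, 117, 143, 250],
      [87, 155, 229], [93, 187, 230], [95, 191], [102, 169], [103, 171, 220], [107, 183, 236],
      [109, 174, 243], [110, 173, 211], [111, 179, 248], [115, 175, 244], [118, 185],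
      [119, 158, 233], [121, 182, 234], [123, 167, 252], [125, 190, 227], [126, 249], [127, 159],
      [186, 207, 245], [189, 246], [199, 253], [203, 254], [205, 247], [206, 251], [215, 237],
      [217, 242], [219, 238]],
    Cover [[31, 115, 205, 230], [47, 223], [54, 171, 213], [55, 219, 236], [59, 188, 215],
      [61, 158, 243], [62, 185, 199], [63, 207], [87, 174, 187], [91, 151, 252], [93, 190, 211],
      [95, 175, 244], [103, 153, 214], [107, 157, 246], [109, 155, 182], [111, 159, 242],
      [117, 186], [118, 217], [119, 249], [123, 245], [125, 179, 222], [126, 221], [127, 143],
      [167, 253], [173, 247], [181, 203, 220], [183, 218, 237], [189, 231], [235, 254], [238, 251],
      [239, 250]],
    Cover [[31, 174, 233, 248], [47, 223], [54, 185, 205], [55, 199, 249], [59, 215, 252],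
      [61, 222, 243], [62, 89, 206], [63, 207, 241], [79, 191], [87, 124, 187], [91, 183],
      [93, 190, 227], [94, 115, 189], [95, 175], [103, 253], [107, 126, 157], [109, 247],
      [110, 123, 181], [111, 158, 245], [117, 220], [118, 173, 219], [119, 237], [121, 182],
      [122, 151], [125, 186, 231], [159, 179], [167, 188, 217], [213, 235, 254], [221, 246],
      [238, 251], [239, 250]],
    Cover [[47, 79, 213, 242], [55, 87, 205, 234], [59, 221, 231], [63, 223], [93, 103, 187], [95, 191],
      [102, 211, 220], [107, 117, 182, 206], [109, 115, 174, 214], [110, 219], [111, 158],
      [118, 203], [119, 155], [121, 157, 186, 230], [123, 222], [125, 190], [126, 189], [127, 159],
      [171, 247], [173, 246], [175, 215], [179, 239], [181, 238], [183, 207], [185, 236],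
      [217, 244], [235, 245], [237, 243], [249, 254], [250, 253], [251, 252]],
    Cover [[31, 239], [47, 186, 205, 244], [54, 91, 171], [55, 237], [59, 213, 236], [61, 222, 231],
      [62, 203], [63, 207], [87, 174, 233], [93, 254], [95, 238], [103, 189, 250],
      [107, 155, 188, 214, 229], [109, 158, 243], [111, 159, 242], [115, 221, 230], [117, 251],
      [118, 157, 227], [119, 249], [123, 252], [125, 218], [126, 235], [127, 220], [173, 182, 234],
      [175, 245], [183, 219], [187, 215], [190, 217], [191, 211], [201, 246]],
    Cover [[31, 107, 248], [47, 223], [54, 202], [55, 219], [59, 117, 238], [61, 158, 243],
      [62, 213, 235], [63, 207], [87, 155, 252], [91, 171, 236, 246], [94, 233], [95, 175, 242],
      [103, 189, 250], [110, 115, 157], [111, 159, 244], [118, 203], [119, 173, 218],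
      [121, 183, 206], [122, 217, 230], [123, 174, 214], [124, 187, 215], [125, 222],
      [126, 221, 227], [127, 220], [182, 234], [186, 231, 253], [188, 251], [190, 249], [191, 211],
      [237, 247], [239, 245]],
    Cover [[31, 47, 244], [54, 198, 248], [55, 199, 249], [59, 238], [61, 222], [62, 206, 240],
      [63, 207, 241], [87, 175, 250], [91, 173, 246], [94, 253], [95, 167, 252],
      [103, 122, 188, 217, 233], [107, 157, 242], [110, 159, 243], [111, 158, 245], [115, 189, 230],
      [117, 186, 239], [118, 185, 220, 234], [119, 218, 237], [121, 182], [123, 181, 214],
      [124, 179, 223], [125, 231], [126, 221, 227], [127, 229], [151, 251], [183, 219, 236],
      [187, 215], [190, 213, 235], [191, 211]],
    Cover [[30, 166, 249], [31, 184, 231], [47, 215, 252], [55, 186, 229], [59, 221, 246],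
      [61, 87, 174, 241], [62, 181, 227], [63, 199, 217], [79, 183], [91, 189], [93, 182],
      [95, 167, 185], [103, 158, 233], [107, 190], [111, 151, 250], [119, 253], [121, 230],
      [123, 157, 238], [125, 247], [126, 179, 237], [127, 245], [143, 251], [155, 239], [159, 235],
      [171, 223], [173, 222, 243], [175, 219], [187, 207], [205, 211, 254]],
    Cover [[30, 230, 248], [31, 231, 249], [47, 87, 250], [55, 125, 206], [59, 93, 238], [61, 119, 218],
      [62, 237, 243], [63, 236, 242], [79, 182, 252], [91, 188, 246], [94, 173, 179],
      [95, 107, 244], [102, 120, 158], [103, 121, 159], [109, 115, 190], [110, 187, 221],
      [111, 186, 220], [117, 222, 234], [118, 205, 211], [122, 175, 215], [123, 174, 214],
      [126, 171, 213], [183, 253], [189, 247], [191, 245], [207, 251], [219, 239], [223, 235]],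
    Cover [[30, 103, 121], [31, 235], [47, 91, 188, 214], [55, 93, 186, 206], [59, 79, 182, 220],
      [61, 87, 174, 218], [62, 237, 243], [94, 227, 233], [107, 254], [111, 250], [119, 125],
      [123, 238], [127, 234], [158, 230, 248], [159, 231, 249], [171, 223], [173, 179, 222],
      [175, 219], [183, 189], [187, 207], [190, 205, 211], [191, 203], [215, 221], [246, 252],
      [247, 253]],
    Cover [[30, 241], [31, 121, 231], [47, 87, 248], [55, 79, 186, 220], [59, 93, 230],
      [61, 91, 174, 214], [62, 179, 237], [63, 213], [94, 205, 243], [95, 171], [103, 159, 249],
      [109, 115, 254], [111, 250], [119, 252], [123, 238], [125, 246], [126, 233], [127, 236],
      [158, 242], [173, 222, 227], [175, 215], [182, 188, 206, 218], [183, 253], [187, 221],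
      [189, 247], [190, 211, 229], [191, 245], [207, 251], [219, 239], [223, 235]],
    Cover [[31, 239], [55, 185, 205, 230], [59, 206, 229], [61, 179, 199, 236], [63, 207], [79, 191],
      [87, 173, 250], [91, 183], [93, 175, 186, 234], [94, 237], [95, 167, 242],
      [103, 157, 182, 233], [107, 158, 165], [109, 151, 188, 227], [111, 159, 248], [118, 189, 218],
      [119, 249], [122, 217, 231], [123, 245], [125, 254], [126, 253], [127, 252], [181, 222],
      [187, 238], [190, 235], [215, 251], [219, 247], [221, 246], [223, 243]],
    Cover [[31, 237], [55, 249], [59, 245], [61, 254], [63, 252], [87, 233], [93, 235, 246],
      [94, 115, 173, 213], [95, 175, 244], [101, 171], [103, 169, 182, 218], [109, 186, 214, 217],
      [111, 159, 248], [117, 187, 220], [118, 221], [119, 185, 204], [121, 181, 222], [122, 239],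
      [123, 207], [124, 191], [125, 190], [126, 189], [127, 188], [155, 179, 236], [157, 231, 250],
      [158, 229], [183, 238], [205, 241], [215, 251], [219, 247], [223, 243]],
    Cover [[31, 121, 231], [47, 186, 215], [55, 222, 237], [59, 213, 230], [61, 91, 199], [62, 171, 181],
      [63, 214, 229], [79, 183, 249], [85, 166, 248], [87, 175, 218], [93, 174],
      [94, 189, 211, 227], [95, 167, 233], [103, 159, 244], [109, 115, 254], [111, 151, 252],
      [117, 182], [118, 188], [119, 143, 250], [123, 246], [125, 238], [126, 173, 243], [127, 242],
      [158, 179, 253], [187, 245], [190, 221], [191, 241], [207, 251], [219, 239], [223, 235]],
    Cover [[31, 103, 185, 244], [47, 87, 188, 241], [53, 122, 205], [55, 222], [59, 118, 157, 229],
      [61, 219, 238], [62, 115, 173, 213], [79, 183, 248], [94, 253], [95, 252], [111, 187],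
      [117, 155, 230], [119, 218], [123, 175], [125, 174, 211], [126, 221], [127, 220], [158, 247],
      [159, 246], [181, 207, 250], [189, 206], [190, 215], [191, 214], [231, 249], [237, 243],
      [239, 251]],
    Split
      [51, 55, 59, 63, 115, 123, 179, 183, 243]
      [204, 205, 206, 207, 220, 222, 236, 237, 252]
      (Split
         [85, 87, 93, 95, 117, 125, 213, 215, 245]
         [170, 171, 174, 175, 186, 190, 234, 235, 250]
         (Cover [[102, 187, 204], [103, 220], [111, 159], [118, 171], [119, 153], [126, 189], [155, 231],
            [157, 234], [170, 221], [174, 217], [185, 206], [186, 205], [219, 246], [230, 249]])
         (Cover [[85, 238], [87, 236], [93, 230], [102, 205], [103, 220], [110, 157], [111, 189],
            [117, 155], [118, 249], [119, 153, 204], [126, 159], [185, 206], [217, 246], [219, 231]]))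
      (Split
         [85, 87, 93, 95, 117, 125, 213, 215, 245]
         [170, 171, 174, 175, 186, 190, 234, 235, 250]
         (Cover [[51, 238], [55, 234], [59, 102], [103, 155], [110, 179], [111, 159], [115, 157],
            [118, 171], [119, 153, 170], [126, 189], [174, 217], [185, 230], [219, 231], [246, 249]])
         (Cover [[51, 93, 230], [55, 217], [59, 213], [85, 102, 187], [87, 185], [103, 159], [110, 179],
            [115, 157], [117, 155], [118, 219], [119, 153], [126, 249], [189, 246]])),
    Cover [[31, 254], [43, 83, 124, 141, 166], [47, 215, 252], [55, 207, 250], [59, 221, 246],
      [61, 219, 238], [62, 115, 143], [63, 222, 244], [79, 183, 249], [87, 175, 248],
      [91, 109, 167], [93, 118, 187, 236], [94, 191, 241], [95, 190, 233], [103, 253],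
      [107, 217, 242], [110, 189, 243], [111, 220, 245], [117, 218, 239], [119, 186, 237],
      [120, 171, 199], [121, 174, 203], [122, 173, 179], [123, 157, 230], [125, 155, 231],
      [126, 159, 227], [127, 158, 229], [151, 188, 235], [181, 206, 251], [182, 205, 211],
      [185, 247], [213, 214], [223, 234]]]"

lemma certificates_valid:
  "list_all2 (\<lambda>R c. certifies (paths R) [] c) (dense_graphs ! 6) certificates"
  by code_simp

lemma card_le_34:
  fixes V :: "'a set"
  assumes "is_graph V E" "card V = 6" "card E = 8" "\<And>v. v \<in> V \<Longrightarrow> \<exists>e\<in>E. v \<in> e"
    and "\<G> \<subseteq> Pow E" "path_intersecting \<G>"
  shows "card \<G> \<le> 34"
proof -
  have "min_size ! Suc 5 \<le> card E"
    by (simp add: min_size_def assms(3))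
  moreover have "\<exists>R\<in>set (dense_graphs ! 5). \<exists>f :: nat \<Rightarrow> 'a. drawing 5 R f V' E'"
    if "is_graph V' E'" "card V' = 5" "min_size ! 5 \<le> card E'" for V' :: "'a set" and E'
    by (rule drawing_of_dense_graph[OF order_refl that])
  ultimately have "\<exists>R\<in>set (dense_graphs ! Suc 5). \<exists>f. drawing (Suc 5) R f V E"
    using assms(2,4) by (intro drawing_of_dense_graph_step[of 5 V E] assms(1)) (simp_all add: assms(3))
  then obtain R f where R: "R \<in> set (dense_graphs ! Suc 5)" and dr: "drawing (Suc 5) R f V E"
    by blast
  have "Suc 5 = 6"
    by simp
  obtain c where "certifies (paths R) [] c"
    using ex_list_all2_partner[OF certificates_valid R[unfolded \<open>Suc 5 = 6\<close>]] by blast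
  then show ?thesis
    using card_le_if_certifies_drawing[OF dr] assms(3,5,6) by blast
qed

section \<open>The theorem\<close>

lemma incident_edge_if_connected:
  assumes "connected_graph V E" "card V \<ge> 2" "v \<in> V"
  shows "\<exists>e\<in>E. v \<in> e"
proof -
  have "V \<noteq> {v}"
    using assms(2) by auto
  then obtain u where "u \<in> V" "u \<noteq> v"
    using assms(3) by blast
  then have "(v, u) \<in> {(x, y). {x, y} \<in> E}\<^sup>*"
    using assms(1,3) by (simp add: connected_graph_def)
  then obtain w where "(v, w) \<in> {(x, y). {x, y} \<in> E}"
    using \<open>u \<noteq> v\<close> by (metis converse_rtranclE)
  then have "{v, w} \<in> E"
    by simp
  then show ?thesis
    by blast
qed

theorem theorem5p3:
  fixes V :: "'a set" and E :: "'a set set" and \<G> :: "'a set set set"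
  assumes "connected_graph V E"
    and "card V = 6"
    and "card E = 7 \<or> card E = 8"
    and "P4_intersecting V E \<G>"
  shows "real (card \<G>) / 2 ^ card E \<le> 17 / 128"
proof -
  have graph: "is_graph V E"
    using assms(1) by (simp add: connected_graph_def)
  then have fin: "finite V" "finite E"
    using finite_subset[of E "Pow V"] by (auto simp: is_graph_def)
  have incident: "\<exists>e\<in>E. v \<in> e" if "v \<in> V" for v
    using incident_edge_if_connected[OF assms(1) _ that] assms(2) by simp
  have sub: "\<G> \<subseteq> Pow E" and inter: "path_intersecting \<G>"
    using assms(4) has_path_if_contains_P4 unfolding P4_intersecting_def path_intersecting_def by blast+
  from assms(3) show ?thesis
  proof
    assume E: "card E = 7"
    have pairs: "card {e. e \<subseteq> V \<and> card e = 2} = 15"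
      unfolding n_subsets[OF fin(1)] assms(2) by (simp add: choose_two)
    \<comment> \<open>Fifteen pairs of vertices, but only seven edges: some pair is free to become an edge.\<close>
    have "\<not> {e. e \<subseteq> V \<and> card e = 2} \<subseteq> E"
      using card_mono[OF fin(2), of "{e. e \<subseteq> V \<and> card e = 2}"] unfolding pairs E by linarith
    then obtain e where e: "e \<subseteq> V" "card e = 2" "e \<notin> E"
      by blast
    note extended = path_intersecting_add_edge[OF fin(2) e(3) sub inter]
    have "card (\<G> \<union> insert e ` \<G>) \<le> 34"
    proof (rule card_le_34[OF _ assms(2) _ _ extended(1,2)])
      show "is_graph V (insert e E)"
        using graph e by (simp add: is_graph_def)
      show "card (insert e E) = 8"
        using fin(2) e(3) E by simp
      show "\<exists>e'\<in>insert e E. v \<in> e'" if "v \<in> V" for v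
        using incident[OF that] by blast
    qed
    then have "card \<G> \<le> 17"
      using extended(3) by simp
    then show ?thesis
      by (simp add: E)
  next
    assume E: "card E = 8"
    have "card \<G> \<le> 34"
      by (rule card_le_34[OF graph assms(2) E incident sub inter])
    then show ?thesis
      by (simp add: E)
  qed
qed

end
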